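(* Let $A_i=T(a_i)+E_i$, $i=-1,0,1$, be the semi-infinite matrices described in the context, and assume $A_{-1}\mathbf 1>A_1\mathbf 1$. Let $\Delta_{A_i}=T(\delta_i)+E_{\delta_i}\in\mathcal{QT}$, $i=-1,0,1$, be perturbations such that $A_i+\Delta_{A_i}\ge0$ and $\sum_{i=-1}^1(A_i+\Delta_{A_i})\mathbf 1=\mathbf 1$. For $|z|=1$ let $g(z)$ be the solution of minimum modulus of \[ a_{-1}(z)+a_0(z)\lambda+a_1(z)\lambda^2=\lambda , \] and let $g(z)+\delta_g(z)$ be the solution of minimum modulus of \[ a_{-1}(z)+\delta_{-1}(z)+(a_0(z)+\delta_0(z))\mu+(a_1(z)+\delta_1(z))\mu^2=\mu . \] Then, up to higher order terms in the perturbations, \[ \|\delta_g\|_w\le\frac1{a_{-1}(1)-a_1(1)}\bigl(\|\delta_1\|_w+\|\delta_0\|_w+\|\delta_{-1}\|_w\bigr), \] that is, the inequality holds with a term $O\bigl((\|\delta_{-1}\|_w+\|\delta_0\|_w+\|\delta_1\|_w)^2\bigr)$ added to the right-hand side as the perturbations tend to $0$. Moreover, if $a_{-1},a_0,a_1$ are all nonzero and $\epsilon=\max\{\|\delta_i\|_w/\|a_i\|_w:\ i=-1,0,1\}$, then \[ \frac{\|\delta_g\|_w}{\|g\|_w}=\|\delta_g\|_w\le\frac{1}{a_{-1}(1)-a_1(1)}\,\epsilon+O(\epsilon^2). \]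
   Context: For $i=-1,0,1$, $A_i$ is the semi-infinite tridiagonal matrix (rows and columns indexed by $1,2,\ldots$) whose first row is $[b_{i,0},b_{i,1},0,\ldots]$ and whose $r$-th row, $r\ge2$, has entries $a_{i,-1},a_{i,0},a_{i,1}$ in columns $r-1,r,r+1$ and zeros elsewhere. Here $a_{i,j}\ge0$, $b_{i,j}\ge0$, $\sum_{i,j=-1}^1a_{i,j}=1$ and $\sum_{i=-1}^1\sum_{j=0}^1b_{i,j}=1$. Hence $(A_{-1}+A_0+A_1)\mathbf 1=\mathbf 1$, where $\mathbf 1$ is the infinite vector of all ones. Set $a_i(z)=a_{i,-1}z^{-1}+a_{i,0}+a_{i,1}z$ and $b_i(z)=b_{i,0}+b_{i,1}z$. Inequalities between vectors and matrices are entrywise; thus $A_{-1}\mathbf 1>A_1\mathbf 1$ means $a_{-1}(1)>a_1(1)$ and $b_{-1}(1)>b_1(1)$. The Wiener class is $\mathcal W=\{f(z)=\sum_{i\in\mathbb Z}f_iz^i:\ \|f\|_w:=\sum_{i\in\mathbb Z}|f_i|<\infty\}$. For $f\in\mathcal W$, $T(f)$ is the semi-infinite Toeplitz matrix with $(T(f))_{i,j}=f_{j-i}$. $\mathcal{QT}$ is the set of matrices $T(f)+E$ with $f\in\mathcal W$ and $E=(e_{i,j})$ such that $\sup_i\sum_j|e_{i,j}|<\infty$ and $\lim_{i\to\infty}\sum_j|e_{i,j}|=0$. Then $A_i=T(a_i)+E_i\in\mathcal{QT}$, where $E_i$ is zero except for its first row $[b_{i,0}-a_{i,0},b_{i,1}-a_{i,1},0,\ldots]$.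 It is known that $g\in\mathcal W$ has nonnegative coefficients and $\|g\|_w=g(1)=1$; $g$ is the symbol of the Toeplitz part of the minimal nonnegative solution of $A_1X^2+A_0X+A_{-1}=X$. Likewise $g+\delta_g$ is the symbol of the Toeplitz part of the minimal nonnegative solution of the equation with coefficients $A_i+\Delta_{A_i}$; it belongs to $\mathcal W$ and has nonnegative coefficients. *)

theory Defs
  imports "HOL-Analysis.Analysis" "HOL-Library.Complex_Order"
begin

section \<open>The Wiener class\<close>

text \<open>
  Elements of the Wiener class are represented by functions on the complex plane of which only
  the values on the unit circle matter.
\<close>

definition wiener_series :: "(int \<Rightarrow> complex) \<Rightarrow> (complex \<Rightarrow> complex) \<Rightarrow> bool" where
  "wiener_series c f \<longleftrightarrow>
     (\<lambda>k. cmod (c k)) summable_on UNIV \<and>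
     (\<forall>z. cmod z = 1 \<longrightarrow> ((\<lambda>k. c k * z powi k) has_sum f z) UNIV)"

definition wiener_class :: "(complex \<Rightarrow> complex) set" where
  "wiener_class = {f. \<exists>c. wiener_series c f}"

text \<open>The coefficient sequence is unique, see \<open>wiener_coeff_eqI\<close> below.\<close>

definition wiener_coeff :: "(complex \<Rightarrow> complex) \<Rightarrow> int \<Rightarrow> complex" where
  "wiener_coeff f = (THE c. wiener_series c f)"

definition wiener_norm :: "(complex \<Rightarrow> complex) \<Rightarrow> real" where
  "wiener_norm f = (\<Sum>\<^sub>\<infinity>k. cmod (wiener_coeff f k))"

lemma has_integral_cis_period:
  fixes m :: int
  shows "((\<lambda>t. cis (of_int m * t)) has_integral (if m = 0 then of_real (2 * pi) else 0)) {0..2 * pi}"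
proof (cases "m = 0")
  case True
  then show ?thesis
    using has_integral_const_real[of "1 :: complex" 0 "2 * pi"] by (simp add: scaleR_conv_of_real)
next
  case False
  define F where "F = (\<lambda>t::real. cis (of_int m * t) / (\<i> * of_int m))"
  have "((\<lambda>t. cis (of_int m * t)) has_integral (F (2 * pi) - F 0)) {0..2 * pi}"
  proof (rule fundamental_theorem_of_calculus)
    fix t :: real
    have cis: "cis (of_int m * s) = exp (s *\<^sub>R (\<i> * of_int m))" for s
      by (simp add: cis_conv_exp scaleR_conv_of_real mult_ac)
    have "(F has_vector_derivative (cis (of_int m * t) * (\<i> * of_int m)) / (\<i> * of_int m))
            (at t within {0..2 * pi})"
      unfolding F_def cis
      by (intro has_vector_derivative_divide exp_scaleR_has_vector_derivative_right)
    then show "(F has_vector_derivative cis (of_int m * t)) (at t within {0..2 * pi})"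
      using False by simp
  qed simp
  moreover have "cis (of_int m * (2 * pi)) = 1"
    using cis_multiple_2pi[of "of_int m"] by (simp add: mult_ac)
  then have "F (2 * pi) - F 0 = 0" by (simp add: F_def)
  ultimately show ?thesis using False by simp
qed

lemma wiener_series_unique:
  assumes "wiener_series c f" "wiener_series d f"
  shows "c = d"
proof
  fix n :: int
  define e where "e k = c k - d k" for k
  have sm: "(\<lambda>k. cmod (c k) + cmod (d k)) summable_on UNIV"
    using assms by (auto simp: wiener_series_def intro: summable_on_add)
  have hs: "((\<lambda>k. e k * z powi k) has_sum 0) UNIV" if "cmod z = 1" for z
  proof -
    have "((\<lambda>k. c k * z powi k + - (d k * z powi k)) has_sum (f z + - f z)) UNIV"
      using assms that by (intro has_sum_add) (auto simp: wiener_series_def has_sum_uminus)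
    then show ?thesis by (simp add: e_def algebra_simps)
  qed
  have hs': "((\<lambda>k. e k * cis (of_int (k - n) * t)) has_sum 0) UNIV" for t
  proof -
    have "((\<lambda>k. e k * cis t powi k * cis (- of_int n * t)) has_sum 0 * cis (- of_int n * t)) UNIV"
      by (intro has_sum_cmult_left hs) simp
    moreover have "e k * cis t powi k * cis (- of_int n * t) = e k * cis (of_int (k - n) * t)" for k
      by (simp add: cis_power_int cis_mult algebra_simps)
    ultimately show ?thesis by (simp only: mult_zero_left)
  qed
  have ul: "uniform_limit {0..2 * pi} (\<lambda>X t. \<Sum>k\<in>X. e k * cis (of_int (k - n) * t)) (\<lambda>t. 0)
          (finite_subsets_at_top UNIV)"
    by (rule Weierstrass_m_test_general'[OF _ hs' sm])
       (simp add: norm_mult e_def norm_triangle_ineq4)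
  obtain I J where IJ:
    "\<And>X. ((\<lambda>t. \<Sum>k\<in>X. e k * cis (of_int (k - n) * t)) has_integral I X) {0..2 * pi}"
    "((\<lambda>t. 0 :: complex) has_integral J) {0..2 * pi}"
    "(I \<longlongrightarrow> J) (finite_subsets_at_top UNIV)"
    by (rule uniform_limit_integral[OF ul]) (auto intro!: continuous_intros)
  have "J = 0" using IJ(2) has_integral_0 has_integral_unique by blast
  have I: "I X = e n * of_real (2 * pi)" if "finite X" "n \<in> X" for X
  proof -
    have "((\<lambda>t. \<Sum>k\<in>X. e k * cis (of_int (k - n) * t)) has_integral
        (\<Sum>k\<in>X. e k * (if k - n = 0 then of_real (2 * pi) else 0))) {0..2 * pi}"
      by (intro has_integral_sum that has_integral_mult_right has_integral_cis_period)
    then have "I X = (\<Sum>k\<in>X. e k * (if k - n = 0 then of_real (2 * pi) else 0))"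
      using IJ(1) has_integral_unique by blast
    also have "\<dots> = (\<Sum>k\<in>X. if n = k then e n * of_real (2 * pi) else 0)"
      by (intro sum.cong) auto
    finally show ?thesis using that by simp
  qed
  have "eventually (\<lambda>X. finite X \<and> {n} \<subseteq> X) (finite_subsets_at_top (UNIV :: int set))"
    unfolding eventually_finite_subsets_at_top by (rule exI[of _ "{n}"]) auto
  then have "eventually (\<lambda>X. I X = e n * of_real (2 * pi)) (finite_subsets_at_top UNIV)"
    by (rule eventually_mono) (use I in auto)
  then have "(I \<longlongrightarrow> e n * of_real (2 * pi)) (finite_subsets_at_top UNIV)"
    by (rule tendsto_eventually)
  then have "e n * of_real (2 * pi) = J"
    using IJ(3) by (rule tendsto_unique[OF finite_subsets_at_top_neq_bot])
  then show "c n = d n" using \<open>J = 0\<close> by (simp add: e_def)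
qed

lemma wiener_coeff_eqI: "wiener_series c f \<Longrightarrow> wiener_coeff f = c"
  unfolding wiener_coeff_def by (rule the_equality) (auto intro: wiener_series_unique)

section \<open>Semi-infinite matrices\<close>

text \<open>
  Rows and columns are numbered from 0 instead of 1; Toeplitz matrices are not affected by this
  shift. Inequalities between complex numbers are those of \<open>Complex_Order\<close>: both sides have
  the same imaginary part, so \<open>0 \<le> w\<close> says that \<open>w\<close> is real and nonnegative.
\<close>

type_synonym inf_matrix = "nat \<Rightarrow> nat \<Rightarrow> complex"

definition row_sum :: "inf_matrix \<Rightarrow> nat \<Rightarrow> complex" where
  "row_sum M r = (\<Sum>\<^sub>\<infinity>c. M r c)"  \<comment> \<open>the \<open>r\<close>-th entry of \<open>M\<close> applied to the all-ones vector\<close>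

definition toeplitz :: "(complex \<Rightarrow> complex) \<Rightarrow> inf_matrix" where
  "toeplitz f r c = wiener_coeff f (int c - int r)"

definition qt_correction :: "inf_matrix \<Rightarrow> bool" where
  "qt_correction E \<longleftrightarrow>
     (\<forall>r. (\<lambda>c. cmod (E r c)) summable_on UNIV) \<and>
     bdd_above (range (\<lambda>r. \<Sum>\<^sub>\<infinity>c. cmod (E r c))) \<and>
     (\<lambda>r. \<Sum>\<^sub>\<infinity>c. cmod (E r c)) \<longlonglongrightarrow> 0"

definition qt_decomposition :: "inf_matrix \<Rightarrow> (complex \<Rightarrow> complex) \<Rightarrow> inf_matrix \<Rightarrow> bool" where
  "qt_decomposition M f E \<longleftrightarrow>
     f \<in> wiener_class \<and> qt_correction E \<and> (\<forall>r c. M r c = toeplitz f r c + E r c)"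

section \<open>Random-walk blocks and their perturbations\<close>

definition block :: "(int \<Rightarrow> int \<Rightarrow> real) \<Rightarrow> (int \<Rightarrow> int \<Rightarrow> real) \<Rightarrow> int \<Rightarrow> inf_matrix" where
  "block a b i r c =
     (if r = 0 then (if c \<in> {0, 1} then of_real (b i (int c)) else 0)
      else (if int c - int r \<in> {-1, 0, 1} then of_real (a i (int c - int r)) else 0))"

definition symb :: "(int \<Rightarrow> int \<Rightarrow> real) \<Rightarrow> int \<Rightarrow> 'a \<Rightarrow> 'a::real_normed_field" where
  "symb a i z = of_real (a i (-1)) * inverse z + of_real (a i 0) + of_real (a i 1) * z"

definition admissible_perturbation ::
  "(int \<Rightarrow> inf_matrix) \<Rightarrow> (int \<Rightarrow> inf_matrix) \<Rightarrow> (int \<Rightarrow> complex \<Rightarrow> complex) \<Rightarrow> (int \<Rightarrow> inf_matrix) \<Rightarrow> bool"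
where
  "admissible_perturbation A \<Delta> \<delta> E \<longleftrightarrow>
     (\<forall>i\<in>{-1, 0, 1}. qt_decomposition (\<Delta> i) (\<delta> i) (E i)) \<and>
     (\<forall>i\<in>{-1, 0, 1}. \<forall>r c. 0 \<le> A i r c + \<Delta> i r c) \<and>
     (\<forall>r. (\<Sum>i\<in>{-1, 0, 1}. row_sum (\<lambda>r c. A i r c + \<Delta> i r c) r) = 1)"

definition quad_solution :: "(int \<Rightarrow> complex \<Rightarrow> complex) \<Rightarrow> complex \<Rightarrow> complex \<Rightarrow> bool" where
  "quad_solution \<alpha> z x \<longleftrightarrow> \<alpha> (-1) z + \<alpha> 0 z * x + \<alpha> 1 z * x ^ 2 = x"

definition min_modulus_solution :: "(int \<Rightarrow> complex \<Rightarrow> complex) \<Rightarrow> (complex \<Rightarrow> complex) \<Rightarrow> bool" where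
  "min_modulus_solution \<alpha> g \<longleftrightarrow>
     (\<forall>z. cmod z = 1 \<longrightarrow>
        quad_solution \<alpha> z (g z) \<and> (\<forall>x. quad_solution \<alpha> z x \<longrightarrow> cmod (g z) \<le> cmod x))"

end

theory Submission
  imports Defs
begin

text \<open>
  Put \<open>\<theta> = a\<^sub>-\<^sub>1(1) - a\<^sub>1(1)\<close>, so that \<open>\<parallel>a\<^sub>0\<parallel> + 2 \<parallel>a\<^sub>1\<parallel> = 1 - \<theta>\<close>. If
  \<open>\<parallel>p\<^sub>-\<^sub>1\<parallel> + \<parallel>p\<^sub>0\<parallel> + \<parallel>p\<^sub>1\<parallel> \<le> 1\<close> and \<open>\<parallel>p\<^sub>0\<parallel> + 2 \<parallel>p\<^sub>1\<parallel> < 1\<close>, then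
  \<open>x \<mapsto> p\<^sub>-\<^sub>1 + p\<^sub>0 x + p\<^sub>1 x\<^sup>2\<close> is a contraction of the closed unit ball of the Wiener algebra, and
  at each point of the unit circle it has at most one fixed point in the closed unit disc. Hence
  the minimum modulus solution is the fixed point of the contraction and has norm at most \<open>1\<close>.
  Both the original and the slightly perturbed symbols are of this kind. Subtracting the two
  equations and writing \<open>G = g + \<delta>\<^sub>g\<close> gives
  \<open>\<delta>\<^sub>g = \<delta>\<^sub>-\<^sub>1 + \<delta>\<^sub>0 G + \<delta>\<^sub>1 G\<^sup>2 + (a\<^sub>0 + a\<^sub>1 (g + G)) \<delta>\<^sub>g\<close>, and taking norms yields
  \<open>\<theta> \<parallel>\<delta>\<^sub>g\<parallel> \<le> \<parallel>\<delta>\<^sub>-\<^sub>1\<parallel> + \<parallel>\<delta>\<^sub>0\<parallel> + \<parallel>\<delta>\<^sub>1\<parallel>\<close>, without any higher order term.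
\<close>

section \<open>The Wiener algebra\<close>

lemma wiener_series_coeff: "f \<in> wiener_class \<Longrightarrow> wiener_series (wiener_coeff f) f"
  unfolding wiener_class_def using wiener_coeff_eqI by fastforce

lemma wiener_seriesD:
  assumes "wiener_series c f"
  shows "f \<in> wiener_class" "wiener_coeff f = c" "wiener_norm f = (\<Sum>\<^sub>\<infinity>k. cmod (c k))"
  using assms wiener_coeff_eqI[OF assms] by (auto simp: wiener_class_def wiener_norm_def)

lemma wiener_coeff_has_sum:
  assumes "f \<in> wiener_class"
  shows "((\<lambda>k. cmod (wiener_coeff f k)) has_sum wiener_norm f) UNIV"
    and "cmod z = 1 \<Longrightarrow> ((\<lambda>k. wiener_coeff f k * z powi k) has_sum f z) UNIV"
  using wiener_series_coeff[OF assms] by (auto simp: wiener_series_def wiener_norm_def)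

lemma wiener_norm_nonneg: "0 \<le> wiener_norm f"
  unfolding wiener_norm_def by (rule infsum_nonneg) simp

lemma cmod_le_wiener_norm:
  assumes "f \<in> wiener_class" "cmod z = 1"
  shows "cmod (f z) \<le> wiener_norm f"
  by (rule norm_infsum_le[OF wiener_coeff_has_sum(2)[OF assms] wiener_coeff_has_sum(1)[OF assms(1)]])
     (simp add: norm_mult norm_power_int assms)

text \<open>Only values on the unit circle matter. The equations for \<open>g\<close> and
  \<open>\<delta>g\<close> are known only there, so membership and norm have to be carried over from
  a function that agrees on the circle.\<close>

lemma wiener_cong:
  assumes f: "f \<in> wiener_class" and eq: "\<And>z. cmod z = 1 \<Longrightarrow> h z = f z"
  shows "h \<in> wiener_class" "wiener_norm h = wiener_norm f"
proof -
  have "wiener_series (wiener_coeff f) h"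
    using wiener_series_coeff[OF f] by (auto simp: wiener_series_def eq)
  from wiener_seriesD[OF this] show "h \<in> wiener_class" "wiener_norm h = wiener_norm f"
    by (auto simp: wiener_norm_def)
qed

text \<open>
  An absolutely convergent sum of monomials, in which exponents may repeat, can be regrouped by
  exponent. Products and infinite series in the Wiener algebra are both sums of this kind.
\<close>

lemma wiener_regroup:
  fixes w :: "'a \<Rightarrow> complex" and \<phi> :: "'a \<Rightarrow> int"
  assumes N: "((\<lambda>x. cmod (w x)) has_sum N) UNIV"
    and f: "\<And>z. cmod z = 1 \<Longrightarrow> ((\<lambda>x. w x * z powi \<phi> x) has_sum f z) UNIV"
  shows "f \<in> wiener_class" "wiener_norm f \<le> N"
proof -
  define S where "S n = {x. \<phi> x = n}" for n
  define e where "e n = (\<Sum>\<^sub>\<infinity>x\<in>S n. w x)" for n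
  \<comment> \<open>The fibres of \<open>\<phi>\<close> partition the index type, so a sum over all
    indices can be computed fibre by fibre; \<open>e n\<close> is the regrouped coefficient of
    exponent \<open>n\<close>.\<close>
  have bij: "bij_betw snd (Sigma UNIV S) UNIV"
    by (rule bij_betw_byWitness[where f' = "\<lambda>x. (\<phi> x, x)"]) (auto simp: S_def)
  have abs: "(\<lambda>x. cmod (w x)) summable_on S n" for n
    by (rule summable_on_subset_banach[OF has_sum_imp_summable[OF N]]) simp
  then have e: "(w has_sum e n) (S n)" for n
    unfolding e_def by (rule has_sum_infsum[OF abs_summable_summable])
  have "((\<lambda>p. cmod (w (snd p))) has_sum N) (Sigma UNIV S)"
    using N has_sum_reindex_bij_betw[OF bij, of "\<lambda>x. cmod (w x)"] by simp
  then have N': "((\<lambda>n. \<Sum>\<^sub>\<infinity>x\<in>S n. cmod (w x)) has_sum N) UNIV"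
    by (rule has_sum_SigmaD) (use abs in auto)
  have le: "cmod (e n) \<le> (\<Sum>\<^sub>\<infinity>x\<in>S n. cmod (w x))" for n
    unfolding e_def by (rule norm_infsum_bound) (rule abs)
  have "(\<lambda>n. \<Sum>\<^sub>\<infinity>x\<in>S n. cmod (w x)) summable_on UNIV"
    using N' by (rule has_sum_imp_summable)
  then have sm: "(\<lambda>n. cmod (e n)) summable_on UNIV"
    by (rule summable_on_comparison_test) (use le in auto)
  have "((\<lambda>n. e n * z powi n) has_sum f z) UNIV" if "cmod z = 1" for z
  proof -
    have "((\<lambda>p. w (snd p) * z powi \<phi> (snd p)) has_sum f z) (Sigma UNIV S)"
      using f[OF that] has_sum_reindex_bij_betw[OF bij, of "\<lambda>x. w x * z powi \<phi> x"] by simp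
    then show ?thesis
    proof (rule has_sum_SigmaD)
      fix n
      have "((\<lambda>x. w x * z powi n) has_sum e n * z powi n) (S n)"
        by (intro has_sum_cmult_left e)
      also have "((\<lambda>x. w x * z powi n) has_sum e n * z powi n) (S n) \<longleftrightarrow>
          ((\<lambda>x. w (snd (n, x)) * z powi \<phi> (snd (n, x))) has_sum e n * z powi n) (S n)"
        by (rule has_sum_cong) (simp add: S_def)
      finally show "((\<lambda>x. w (snd (n, x)) * z powi \<phi> (snd (n, x))) has_sum e n * z powi n) (S n)" .
    qed
  qed
  with sm have "wiener_series e f" by (auto simp: wiener_series_def)
  note D = wiener_seriesD[OF this]
  show "f \<in> wiener_class" by (rule D)
  show "wiener_norm f \<le> N" unfolding D(3)
    by (rule has_sum_mono[OF has_sum_infsum[OF sm] N']) (rule le)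
qed

text \<open>Absolute summability of both factors makes the family over pairs absolutely summable,
  which justifies evaluating it as an iterated sum.\<close>

lemma has_sum_product:
  fixes f :: "'a \<Rightarrow> 'c :: {real_normed_field, banach}" and g :: "'b \<Rightarrow> 'c"
  assumes f: "(f has_sum s) A" "f abs_summable_on A" and g: "(g has_sum t) B" "g abs_summable_on B"
  shows "((\<lambda>(x, y). f x * g y) has_sum s * t) (A \<times> B)"
proof (rule has_sum_SigmaI)
  show "((\<lambda>y. case (x, y) of (x, y) \<Rightarrow> f x * g y) has_sum f x * t) B" for x
    using has_sum_cmult_right[OF g(1)] by simp
  show "((\<lambda>x. f x * t) has_sum s * t) A"
    by (rule has_sum_cmult_left[OF f(1)])
  have "(\<lambda>p. norm (f (fst p)) * norm (g (snd p))) summable_on A \<times> B"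
  proof (rule summable_on_SigmaI)
    show "((\<lambda>y. norm (f (fst (x, y))) * norm (g (snd (x, y)))) has_sum
            norm (f x) * (\<Sum>\<^sub>\<infinity>y\<in>B. norm (g y))) B" for x
      using has_sum_cmult_right[OF has_sum_infsum[OF g(2)]] by simp
    show "(\<lambda>x. norm (f x) * (\<Sum>\<^sub>\<infinity>y\<in>B. norm (g y))) summable_on A"
      by (rule summable_on_cmult_left[OF f(2)])
  qed simp
  then have "(\<lambda>(x, y). f x * g y) abs_summable_on A \<times> B"
    by (simp add: case_prod_unfold norm_mult)
  then show "(\<lambda>(x, y). f x * g y) summable_on A \<times> B"
    by (rule abs_summable_summable)
qed

lemma wiener_mult:
  assumes f: "f \<in> wiener_class" and g: "g \<in> wiener_class"
  shows "(\<lambda>z. f z * g z) \<in> wiener_class"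
    and "wiener_norm (\<lambda>z. f z * g z) \<le> wiener_norm f * wiener_norm g"
proof -
  \<comment> \<open>The product is a sum of monomials indexed by pairs \<open>(i, j)\<close> with
    exponent \<open>i + j\<close>. Regrouping by exponent performs the convolution without writing
    it out.\<close>
  define w where "w = (\<lambda>(i, j). wiener_coeff f i * wiener_coeff g j)"
  note F = wiener_coeff_has_sum[OF f] and G = wiener_coeff_has_sum[OF g]
  have sm: "(\<lambda>k. cmod (wiener_coeff f k)) summable_on UNIV"
    "(\<lambda>k. cmod (wiener_coeff g k)) summable_on UNIV"
    using F(1) G(1) by (blast intro: has_sum_imp_summable)+
  have "((\<lambda>(x, y). cmod (wiener_coeff f x) * cmod (wiener_coeff g y)) has_sum
          wiener_norm f * wiener_norm g) (UNIV \<times> UNIV)"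
    by (rule has_sum_product[OF F(1) _ G(1)]) (simp_all add: sm)
  then have N: "((\<lambda>x. cmod (w x)) has_sum wiener_norm f * wiener_norm g) UNIV"
    by (simp add: w_def case_prod_unfold norm_mult)
  have P: "((\<lambda>x. w x * z powi (fst x + snd x)) has_sum f z * g z) UNIV" if z: "cmod z = 1" for z
  proof -
    have "((\<lambda>(i, j). (wiener_coeff f i * z powi i) * (wiener_coeff g j * z powi j)) has_sum
            f z * g z) (UNIV \<times> UNIV)"
      by (rule has_sum_product[OF F(2)[OF z] _ G(2)[OF z]])
         (simp_all add: sm norm_mult norm_power_int z)
    moreover have "z \<noteq> 0" using z by auto
    ultimately show ?thesis
      by (simp add: w_def case_prod_unfold power_int_add mult_ac)
  qed
  show "(\<lambda>z. f z * g z) \<in> wiener_class"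
    and "wiener_norm (\<lambda>z. f z * g z) \<le> wiener_norm f * wiener_norm g"
    using wiener_regroup[OF N P] by auto
qed

lemma wiener_add:
  assumes f: "f \<in> wiener_class" and g: "g \<in> wiener_class"
  shows "(\<lambda>z. f z + g z) \<in> wiener_class"
    and "wiener_norm (\<lambda>z. f z + g z) \<le> wiener_norm f + wiener_norm g"
    and "wiener_coeff (\<lambda>z. f z + g z) k = wiener_coeff f k + wiener_coeff g k"
proof -
  note F = wiener_coeff_has_sum[OF f] and G = wiener_coeff_has_sum[OF g]
  let ?c = "\<lambda>k. wiener_coeff f k + wiener_coeff g k"
  note FG = has_sum_add[OF F(1) G(1)]
  have "(\<lambda>k. cmod (wiener_coeff f k) + cmod (wiener_coeff g k)) summable_on UNIV"
    using FG by (rule has_sum_imp_summable)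
  then have sm: "(\<lambda>k. cmod (?c k)) summable_on UNIV"
    by (rule summable_on_comparison_test) (auto intro: norm_triangle_ineq)
  moreover have "((\<lambda>k. ?c k * z powi k) has_sum f z + g z) UNIV" if "cmod z = 1" for z
    using has_sum_add[OF F(2)[OF that] G(2)[OF that]] by (simp add: algebra_simps)
  ultimately have "wiener_series ?c (\<lambda>z. f z + g z)" by (auto simp: wiener_series_def)
  note D = wiener_seriesD[OF this]
  show "(\<lambda>z. f z + g z) \<in> wiener_class" by (rule D)
  show "wiener_coeff (\<lambda>z. f z + g z) k = ?c k" by (simp add: D)
  show "wiener_norm (\<lambda>z. f z + g z) \<le> wiener_norm f + wiener_norm g" unfolding D(3)
    by (rule has_sum_mono[OF has_sum_infsum[OF sm] FG]) (rule norm_triangle_ineq)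
qed

lemma wiener_finite_support:
  assumes fin: "finite S" and f: "\<And>z. cmod z = 1 \<Longrightarrow> f z = (\<Sum>k\<in>S. c k * z powi k)"
  shows "f \<in> wiener_class" "wiener_norm f = (\<Sum>k\<in>S. cmod (c k))"
    "wiener_coeff f k = (if k \<in> S then c k else 0)"
proof -
  let ?c = "\<lambda>k. if k \<in> S then c k else 0"
  have N: "((\<lambda>k. cmod (?c k)) has_sum (\<Sum>k\<in>S. cmod (c k))) UNIV"
    by (rule has_sum_finite_neutralI[OF fin]) auto
  have "((\<lambda>k. ?c k * z powi k) has_sum f z) UNIV" if "cmod z = 1" for z
    by (rule has_sum_finite_neutralI[OF fin]) (auto simp: f[OF that])
  with N have "wiener_series ?c f" by (auto simp: wiener_series_def intro: has_sum_imp_summable)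
  note D = wiener_seriesD[OF this]
  show "f \<in> wiener_class" by (rule D)
  show "wiener_coeff f k = ?c k" by (simp add: D)
  show "wiener_norm f = (\<Sum>k\<in>S. cmod (c k))" unfolding D(3) using N by (rule infsumI)
qed

lemma wiener_zero: "(\<lambda>z. 0) \<in> wiener_class" "wiener_norm (\<lambda>z. 0) = 0"
  using wiener_finite_support[of "{}" "\<lambda>z. 0"] by auto

lemma wiener_minus:
  assumes f: "f \<in> wiener_class" and g: "g \<in> wiener_class"
  shows "(\<lambda>z. f z - g z) \<in> wiener_class"
proof -
  have "(\<lambda>z. -1) \<in> wiener_class"
    using wiener_finite_support(1)[of "{0}" "\<lambda>z. -1" "\<lambda>_. -1"] by simp
  from wiener_add(1)[OF f wiener_mult(1)[OF this g]] show ?thesis by simp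
qed

section \<open>Norm-convergent series and limits in the Wiener algebra\<close>

lemma wiener_sums:
  assumes f: "\<And>k. f k \<in> wiener_class" and sm: "summable (\<lambda>k. wiener_norm (f k))"
    and F: "\<And>z. cmod z = 1 \<Longrightarrow> (\<lambda>k. f k z) sums F z"
  shows "F \<in> wiener_class" "wiener_norm F \<le> (\<Sum>k. wiener_norm (f k))"
proof -
  \<comment> \<open>Expanding every \<open>f k\<close> gives monomials indexed by pairs of a summand
    and an exponent; regrouping them yields the coefficients of \<open>F\<close>.\<close>
  define w where "w p = wiener_coeff (f (fst p)) (snd p)" for p :: "nat \<times> int"
  note W = wiener_coeff_has_sum[OF f]
  have sum: "((\<lambda>k. wiener_norm (f k)) has_sum (\<Sum>k. wiener_norm (f k))) UNIV"
    using sm by (intro norm_summable_imp_has_sum) (auto simp: wiener_norm_nonneg summable_sums)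
  have abs: "(\<lambda>p. cmod (w p)) summable_on Sigma UNIV (\<lambda>k. UNIV)"
    by (rule summable_on_SigmaI[where g = "\<lambda>k. wiener_norm (f k)"])
       (use W(1) has_sum_imp_summable[OF sum] in \<open>auto simp: w_def\<close>)
  have N: "((\<lambda>p. cmod (w p)) has_sum (\<Sum>k. wiener_norm (f k))) UNIV"
    using has_sum_SigmaI[OF _ sum abs] W(1) by (auto simp: w_def)
  have P: "((\<lambda>p. w p * z powi snd p) has_sum F z) UNIV" if z: "cmod z = 1" for z
  proof -
    have "summable (\<lambda>k. cmod (f k z))"
      by (rule summable_comparison_test_ev[OF _ sm])
         (auto intro!: always_eventually cmod_le_wiener_norm f z)
    then have sum': "((\<lambda>k. f k z) has_sum F z) UNIV"
      by (rule norm_summable_imp_has_sum) (rule F[OF z])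
    have "(\<lambda>p. cmod (w p * z powi snd p)) summable_on Sigma UNIV (\<lambda>k. UNIV)"
      using abs by (simp add: norm_mult norm_power_int z)
    then have "(\<lambda>p. w p * z powi snd p) summable_on Sigma UNIV (\<lambda>k. UNIV)"
      by (rule abs_summable_summable)
    from has_sum_SigmaI[OF _ sum' this] show ?thesis using W(2)[OF z] by (auto simp: w_def)
  qed
  show "F \<in> wiener_class" "wiener_norm F \<le> (\<Sum>k. wiener_norm (f k))"
    using wiener_regroup[OF N P] by auto
qed

text \<open>The limit is the telescoping series of the increments, which converges by comparison
  with a geometric series. Pointwise convergence serves to pass to the limit in an equation, norm
  convergence to keep a norm bound.\<close>

lemma wiener_geometric_limit:
  assumes X: "\<And>k. X k \<in> wiener_class" and q: "0 \<le> q" "q < 1"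
    and step: "\<And>k. wiener_norm (\<lambda>z. X (Suc k) z - X k z) \<le> K * q ^ k"
  obtains G where "G \<in> wiener_class" "\<And>z. cmod z = 1 \<Longrightarrow> (\<lambda>k. X k z) \<longlonglongrightarrow> G z"
    "(\<lambda>n. wiener_norm (\<lambda>z. G z - X n z)) \<longlonglongrightarrow> 0"
proof -
  define D where "D k = (\<lambda>z. X (Suc k) z - X k z)" for k
  have D: "D k \<in> wiener_class" for k unfolding D_def by (intro wiener_minus X)
  have step': "wiener_norm (D (n + k)) \<le> K * q ^ n * q ^ k" for n k
    using step[of "n + k"] by (simp add: D_def power_add mult.assoc)
  have geo: "summable (\<lambda>k. K * q ^ n * q ^ k)" for n
    using q by (intro summable_mult summable_geometric) auto
  have sm: "summable (\<lambda>k. wiener_norm (D (n + k)))" for n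
    by (rule summable_comparison_test_ev[OF _ geo[of n]])
       (use step' in \<open>auto intro!: always_eventually simp: wiener_norm_nonneg\<close>)
  define G where "G z = X 0 z + (\<Sum>k. D k z)" for z
  have lim: "(\<lambda>k. X k z) \<longlonglongrightarrow> G z" if z: "cmod z = 1" for z
  proof -
    have "summable (\<lambda>k. D k z)"
      by (rule summable_comparison_test_ev[OF _ sm[of 0]])
         (auto intro!: always_eventually cmod_le_wiener_norm D z)
    then have "(\<lambda>n. X 0 z + (\<Sum>k<n. D k z)) \<longlonglongrightarrow> G z"
      unfolding G_def by (intro tendsto_intros summable_LIMSEQ)
    moreover have "X 0 z + (\<Sum>k<n. D k z) = X n z" for n
      using sum_lessThan_telescope[of "\<lambda>k. X k z" n] by (simp add: D_def)
    ultimately show ?thesis by simp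
  qed
  \<comment> \<open>The tail of the telescoping series from index \<open>n\<close> is the error
    \<open>G - X n\<close>, so the norm bound for series, applied to tails, estimates this
    error.\<close>
  have sums: "(\<lambda>k. D (n + k) z) sums (G z - X n z)" if "cmod z = 1" for n z
    using telescope_sums[OF LIMSEQ_ignore_initial_segment[OF lim[OF that], of n]]
    by (simp add: D_def add_ac)
  note W = wiener_sums[OF D sm sums]
  have "(\<lambda>z. (G z - X 0 z) + X 0 z) \<in> wiener_class"
    by (rule wiener_add(1)[OF W(1)[of 0] X])
  then have G: "G \<in> wiener_class" by simp
  have bound: "wiener_norm (\<lambda>z. G z - X n z) \<le> K * q ^ n * (1 / (1 - q))" for n
  proof -
    have "(\<Sum>k. wiener_norm (D (n + k))) \<le> (\<Sum>k. K * q ^ n * q ^ k)"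
      by (rule suminf_le[OF step' sm geo])
    also have "\<dots> = K * q ^ n * (1 / (1 - q))"
      using q by (subst suminf_mult) (auto simp: suminf_geometric)
    finally show ?thesis using W(2)[of n] by simp
  qed
  have null: "(\<lambda>n. K * q ^ n * (1 / (1 - q))) \<longlonglongrightarrow> 0"
    using q by (auto intro!: tendsto_eq_intros LIMSEQ_realpow_zero)
  have "(\<lambda>n. wiener_norm (\<lambda>z. G z - X n z)) \<longlonglongrightarrow> 0"
    by (rule tendsto_sandwich[OF always_eventually always_eventually tendsto_const null])
       (intro allI wiener_norm_nonneg bound)+
  with G lim show ?thesis by (rule that)
qed

section \<open>The quadratic equation in the Wiener algebra\<close>

text \<open>Subtracting the two equations shows that \<open>x - y\<close> is fixed under
  multiplication by \<open>p 0 z + p 1 z * (x + y)\<close>, a number of modulus below 1.\<close>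

lemma quad_solution_unique:
  assumes x: "quad_solution p z x" "cmod x \<le> 1" and y: "quad_solution p z y" "cmod y \<le> 1"
    and small: "cmod (p 0 z) + 2 * cmod (p 1 z) < 1"
  shows "x = y"
proof (rule ccontr)
  assume "x \<noteq> y"
  have "(p 0 z + p 1 z * (x + y)) * (x - y) =
      (p (-1) z + p 0 z * x + p 1 z * x ^ 2) - (p (-1) z + p 0 z * y + p 1 z * y ^ 2)"
    by (simp add: algebra_simps power2_eq_square)
  also have "\<dots> = x - y" using x(1) y(1) unfolding quad_solution_def by simp
  finally have "(p 0 z + p 1 z * (x + y)) * (x - y) = x - y" .
  with \<open>x \<noteq> y\<close> have "p 0 z + p 1 z * (x + y) = 1" by simp
  then have "1 \<le> cmod (p 0 z) + cmod (p 1 z) * cmod (x + y)"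
    by (metis norm_mult norm_one norm_triangle_ineq)
  also have "\<dots> \<le> cmod (p 0 z) + cmod (p 1 z) * 2"
    using norm_triangle_ineq[of x y] x(2) y(2) by (intro add_left_mono mult_left_mono) auto
  finally show False using small by simp
qed

text \<open>It serves twice: to keep the iteration in the unit ball, and to bound the terms coming
  from the perturbations of the coefficients.\<close>

lemma wiener_quadratic:
  assumes p: "p \<in> wiener_class" and q: "q \<in> wiener_class" and r: "r \<in> wiener_class"
    and x: "x \<in> wiener_class" "wiener_norm x \<le> 1"
  shows "(\<lambda>z. p z + q z * x z + r z * x z ^ 2) \<in> wiener_class"
    and "wiener_norm (\<lambda>z. p z + q z * x z + r z * x z ^ 2)
          \<le> wiener_norm p + wiener_norm q + wiener_norm r"
proof -
  note xx = wiener_mult[OF x(1) x(1)]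
  note qx = wiener_mult[OF q x(1)] and rxx = wiener_mult[OF r xx(1)]
  note pq = wiener_add[OF p qx(1)]
  note pqr = wiener_add[OF pq(1) rxx(1)]
  show "(\<lambda>z. p z + q z * x z + r z * x z ^ 2) \<in> wiener_class"
    using pqr(1) by (simp add: power2_eq_square)
  have "wiener_norm x * wiener_norm x \<le> 1"
    using x(2) by (simp add: mult_le_one wiener_norm_nonneg)
  with xx(2) have "wiener_norm (\<lambda>z. x z * x z) \<le> 1" by simp
  then have "wiener_norm r * wiener_norm (\<lambda>z. x z * x z) \<le> wiener_norm r"
    by (intro mult_left_le wiener_norm_nonneg)
  moreover have "wiener_norm q * wiener_norm x \<le> wiener_norm q"
    by (intro mult_left_le wiener_norm_nonneg x)
  ultimately show "wiener_norm (\<lambda>z. p z + q z * x z + r z * x z ^ 2)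
      \<le> wiener_norm p + wiener_norm q + wiener_norm r"
    using pqr(2) pq(2) qx(2) rxx(2) by (simp add: power2_eq_square)
qed

text \<open>For \<open>d = x - y\<close> the function is the difference of the values of a quadratic
  at \<open>x\<close> and \<open>y\<close>, its constant term having cancelled. The bound is thus a
  Lipschitz estimate on the unit ball.\<close>

lemma wiener_quadratic_slope:
  assumes q: "q \<in> wiener_class" and r: "r \<in> wiener_class"
    and x: "x \<in> wiener_class" "wiener_norm x \<le> 1"
    and y: "y \<in> wiener_class" "wiener_norm y \<le> 1"
    and d: "d \<in> wiener_class"
  shows "(\<lambda>z. (q z + r z * (x z + y z)) * d z) \<in> wiener_class"
    and "wiener_norm (\<lambda>z. (q z + r z * (x z + y z)) * d z)
          \<le> (wiener_norm q + 2 * wiener_norm r) * wiener_norm d"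
proof -
  note xy = wiener_add[OF x(1) y(1)]
  note rxy = wiener_mult[OF r xy(1)]
  note s = wiener_add[OF q rxy(1)]
  note sd = wiener_mult[OF s(1) d]
  show "(\<lambda>z. (q z + r z * (x z + y z)) * d z) \<in> wiener_class" by (rule sd)
  have "wiener_norm r * wiener_norm (\<lambda>z. x z + y z) \<le> wiener_norm r * 2"
    using xy(2) x(2) y(2) by (intro mult_left_mono wiener_norm_nonneg) simp
  then have "wiener_norm (\<lambda>z. q z + r z * (x z + y z)) \<le> wiener_norm q + 2 * wiener_norm r"
    using s(2) rxy(2) by simp
  then show "wiener_norm (\<lambda>z. (q z + r z * (x z + y z)) * d z)
      \<le> (wiener_norm q + 2 * wiener_norm r) * wiener_norm d"
    using sd(2) by (meson mult_right_mono order_trans wiener_norm_nonneg)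
qed

lemma min_modulus_solution_wiener:
  assumes p: "\<And>i. i \<in> {-1, 0, 1} \<Longrightarrow> p i \<in> wiener_class"
    and le1: "(\<Sum>i\<in>{-1, 0, 1}. wiener_norm (p i)) \<le> 1"
    and small: "wiener_norm (p 0) + 2 * wiener_norm (p 1) < 1"
    and g: "min_modulus_solution p g"
  shows "g \<in> wiener_class" "wiener_norm g \<le> 1"
    and "\<And>z x. cmod z = 1 \<Longrightarrow> quad_solution p z x \<Longrightarrow> cmod x \<le> 1 \<Longrightarrow> g z = x"
proof -
  define B where "B x = (\<lambda>z. p (-1) z + p 0 z * x z + p 1 z * x z ^ 2)"
    for x :: "complex \<Rightarrow> complex"
  define X where "X n = (B ^^ n) (\<lambda>z. 0)" for n
  define q where "q = wiener_norm (p 0) + 2 * wiener_norm (p 1)"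
  have p': "p (-1) \<in> wiener_class" "p 0 \<in> wiener_class" "p 1 \<in> wiener_class"
    by (intro p; simp)+
  have q: "0 \<le> q" "q < 1" using small by (simp_all add: q_def wiener_norm_nonneg)
  have X0: "X 0 = (\<lambda>z. 0)" and XSuc: "X (Suc n) = B (X n)" for n by (simp_all add: X_def)
  have X: "X n \<in> wiener_class \<and> wiener_norm (X n) \<le> 1" for n
  proof (induction n)
    case 0
    show ?case by (simp add: X0 wiener_zero)
  next
    case (Suc n)
    then show ?case
      using wiener_quadratic[OF p', of "X n"] le1 by (simp add: XSuc B_def)
  qed
  have step: "wiener_norm (\<lambda>z. X (Suc k) z - X k z) \<le> 1 * q ^ k" for k
  proof (induction k)
    \<comment> \<open>The iteration starts at zero, so its first increment is \<open>X 1\<close>,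
      which lies in the unit ball; hence the constant 1 in the geometric bound.\<close>
    case 0
    have "(\<lambda>z. X (Suc 0) z - X 0 z) = X (Suc 0)" by (simp add: X0)
    then show ?case using X[of "Suc 0"] by simp
  next
    case (Suc k)
    have "(\<lambda>z. B (X (Suc k)) z - B (X k) z) =
        (\<lambda>z. (p 0 z + p 1 z * (X (Suc k) z + X k z)) * (X (Suc k) z - X k z))"
      by (rule ext) (simp add: B_def algebra_simps power2_eq_square)
    then have eq: "(\<lambda>z. X (Suc (Suc k)) z - X (Suc k) z) =
        (\<lambda>z. (p 0 z + p 1 z * (X (Suc k) z + X k z)) * (X (Suc k) z - X k z))"
      by (simp only: XSuc[symmetric])
    have D: "(\<lambda>z. X (Suc k) z - X k z) \<in> wiener_class"
      using X by (intro wiener_minus) auto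
    have "wiener_norm (\<lambda>z. X (Suc (Suc k)) z - X (Suc k) z)
        \<le> q * wiener_norm (\<lambda>z. X (Suc k) z - X k z)"
      unfolding q_def eq
      by (rule wiener_quadratic_slope(2)[OF p'(2,3) _ _ _ _ D]) (simp_all add: X)
    also have "\<dots> \<le> q * (1 * q ^ k)"
      by (intro mult_left_mono Suc q)
    finally show ?case by simp
  qed
  obtain G where G: "G \<in> wiener_class" "\<And>z. cmod z = 1 \<Longrightarrow> (\<lambda>k. X k z) \<longlonglongrightarrow> G z"
    "(\<lambda>n. wiener_norm (\<lambda>z. G z - X n z)) \<longlonglongrightarrow> 0"
    by (rule wiener_geometric_limit[OF conjunct1[OF X] q step]) blast
  \<comment> \<open>The unit ball is closed: the triangle inequality holds for every
    \<open>n\<close>, and the error term tends to 0.\<close>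
  have "wiener_norm G \<le> wiener_norm (\<lambda>z. G z - X n z) + 1" for n
  proof -
    have "wiener_norm (\<lambda>z. (G z - X n z) + X n z)
        \<le> wiener_norm (\<lambda>z. G z - X n z) + wiener_norm (X n)"
      by (rule wiener_add(2)[OF wiener_minus[OF G(1)]]) (simp_all add: X)
    then show ?thesis using X[of n] by simp
  qed
  then have "wiener_norm G \<le> 0 + 1"
    by (intro LIMSEQ_le_const[OF tendsto_add[OF G(3) tendsto_const]]) simp
  then have G1: "wiener_norm G \<le> 1" by simp
  have Gq: "quad_solution p z (G z)" if z: "cmod z = 1" for z
  proof -
    have "(\<lambda>k. B (X k) z) \<longlonglongrightarrow> p (-1) z + p 0 z * G z + p 1 z * G z ^ 2"
      unfolding B_def by (intro tendsto_intros G z)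
    moreover have "(\<lambda>k. B (X k) z) \<longlonglongrightarrow> G z"
      using LIMSEQ_Suc[OF G(2)[OF z]] by (simp add: XSuc)
    ultimately show ?thesis
      unfolding quad_solution_def by (rule LIMSEQ_unique)
  qed
  have small': "cmod (p 0 z) + 2 * cmod (p 1 z) < 1" if "cmod z = 1" for z
    using small cmod_le_wiener_norm[OF p'(2) that] cmod_le_wiener_norm[OF p'(3) that] by simp
  have le: "cmod (G z) \<le> 1" if "cmod z = 1" for z
    using cmod_le_wiener_norm[OF G(1) that] G1 by simp
  \<comment> \<open>Minimality of \<open>g z\<close> against the competitor \<open>x\<close> places
    it in the closed disc, where the solution is unique.\<close>
  show eq: "g z = x" if z: "cmod z = 1" and x: "quad_solution p z x" "cmod x \<le> 1" for z x
  proof -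
    have "quad_solution p z (g z)" "cmod (g z) \<le> cmod x"
      using g z x by (auto simp: min_modulus_solution_def)
    with x small'[OF z] show ?thesis by (intro quad_solution_unique[of p z]) auto
  qed
  from wiener_cong[OF G(1), of g] eq[OF _ Gq le] G1
  show "g \<in> wiener_class" "wiener_norm g \<le> 1" by auto
qed

section \<open>Symbols of the blocks and of their perturbations\<close>

lemma symb_wiener:
  fixes a :: "int \<Rightarrow> int \<Rightarrow> real"
  shows "symb a i \<in> wiener_class"
    and "wiener_norm (symb a i) = (\<Sum>j\<in>{-1, 0, 1}. \<bar>a i j\<bar>)"
    and "wiener_coeff (symb a i) j = (if j \<in> {-1, 0, 1} then of_real (a i j) else 0)"
proof -
  have "symb a i z = (\<Sum>j\<in>{-1, 0, 1}. of_real (a i j) * z powi j)" for z :: complex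
    by (simp add: symb_def power_int_minus)
  note W = wiener_finite_support[OF _ this]
  show "symb a i \<in> wiener_class"
    and "wiener_norm (symb a i) = (\<Sum>j\<in>{-1, 0, 1}. \<bar>a i j\<bar>)"
    and "wiener_coeff (symb a i) j = (if j \<in> {-1, 0, 1} then of_real (a i j) else 0)"
    using W by simp_all
qed

text \<open>Rows are numbered from 0, so row 1 is the first one free of boundary entries. There the
  drift assumption becomes the inequality between the symbols at 1.\<close>

lemma row_sum_block_interior:
  "row_sum (block a b i) 1 = of_real (\<Sum>j\<in>{-1, 0, 1}. a i j)"
proof -
  have "(block a b i 1 has_sum (\<Sum>c\<in>{0, 1, 2}. block a b i 1 c)) UNIV"
    by (rule has_sum_finite_neutralI[of "{0, 1, 2}"]) (auto simp: block_def)
  then show ?thesis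
    unfolding row_sum_def by (simp add: infsumI block_def)
qed

section \<open>Recovering the perturbed symbols from the rows of the perturbed matrices\<close>

lemma toeplitz_row_abs_summable:
  assumes "f \<in> wiener_class"
  shows "(\<lambda>c. cmod (toeplitz f r c)) summable_on UNIV"
proof -
  have "(\<lambda>k. cmod (wiener_coeff f k)) summable_on range (\<lambda>c. int c - int r)"
    by (rule summable_on_subset_banach[OF has_sum_imp_summable[OF wiener_coeff_has_sum(1)[OF assms]]])
       simp
  then show ?thesis
    by (subst (asm) summable_on_reindex) (auto simp: inj_on_def o_def toeplitz_def)
qed

text \<open>Along the diagonal of offset \<open>j\<close> the Toeplitz parts are eventually
  constant, while each entry of \<open>E\<close> is at most its absolute row sum, which tends to
  0.\<close>

lemma perturbed_block_diagonal_limit: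
  assumes "qt_decomposition D \<delta> E"
  shows "(\<lambda>r. block a b i r (nat (int r + j)) + D r (nat (int r + j)))
          \<longlonglongrightarrow> wiener_coeff (\<lambda>z. symb a i z + \<delta> z) j"
proof -
  have \<delta>: "\<delta> \<in> wiener_class" and E: "qt_correction E"
    and D: "D r c = toeplitz \<delta> r c + E r c" for r c
    using assms by (auto simp: qt_decomposition_def)
  have null: "(\<lambda>r. E r (nat (int r + j))) \<longlonglongrightarrow> 0"
  proof (rule Lim_null_comparison)
    have "cmod (E r (nat (int r + j))) \<le> (\<Sum>\<^sub>\<infinity>c. cmod (E r c))" for r
      using finite_sum_le_infsum[of "\<lambda>c. cmod (E r c)" UNIV "{nat (int r + j)}"] E
      by (simp add: qt_correction_def)
    then show "\<forall>\<^sub>F r in sequentially. cmod (E r (nat (int r + j))) \<le> (\<Sum>\<^sub>\<infinity>c. cmod (E r c))"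
      by (intro always_eventually allI)
    show "(\<lambda>r. \<Sum>\<^sub>\<infinity>c. cmod (E r c)) \<longlonglongrightarrow> 0"
      using E by (simp add: qt_correction_def)
  qed
  have "\<forall>\<^sub>F r in sequentially. wiener_coeff (\<lambda>z. symb a i z + \<delta> z) j + E r (nat (int r + j))
      = block a b i r (nat (int r + j)) + D r (nat (int r + j))"
    \<comment> \<open>Beyond this bound \<open>int r + j\<close> is nonnegative, so
      \<open>nat\<close> does not truncate it, and the boundary row 0 is excluded.\<close>
    using eventually_ge_at_top[of "Suc (nat \<bar>j\<bar>)"]
  proof eventually_elim
    case (elim r)
    then have "int (nat (int r + j)) - int r = j" "r \<noteq> 0" by auto
    then show ?case
      by (simp only: wiener_add(3)[OF symb_wiener(1) \<delta>] symb_wiener(3) D block_def toeplitz_def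
          if_False) (simp add: add.assoc)
  qed
  moreover have "(\<lambda>r. wiener_coeff (\<lambda>z. symb a i z + \<delta> z) j + E r (nat (int r + j)))
      \<longlonglongrightarrow> wiener_coeff (\<lambda>z. symb a i z + \<delta> z) j + 0"
    by (intro tendsto_intros null)
  ultimately show ?thesis
    by (simp add: tendsto_cong)
qed

text \<open>
  Far down the matrix the perturbed rows look like the perturbed symbols, so nonnegativity and the
  unit row sums bound every finite partial sum of the symbols' coefficients by \<open>1\<close>.
\<close>

lemma perturbed_symbols_norm_le_1:
  assumes adm: "admissible_perturbation (block a b) \<Delta> \<delta> E"
  shows "(\<Sum>i\<in>{-1, 0, 1}. wiener_norm (\<lambda>z. symb a i z + \<delta> i z)) \<le> 1"
proof -
  define I :: "int set" where "I = {-1, 0, 1}"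
  define M where "M i r c = block a b i r c + \<Delta> i r c" for i r c
  define p where "p i z = symb a i z + \<delta> i z" for i :: int and z :: complex
  define N where "N i r = (\<Sum>\<^sub>\<infinity>c. cmod (M i r c))" for i r
  have qt: "qt_decomposition (\<Delta> i) (\<delta> i) (E i)" if "i \<in> I" for i
    using adm that unfolding admissible_perturbation_def I_def by blast
  have pos: "0 \<le> M i r c" if "i \<in> I" for i r c
    using adm that unfolding admissible_perturbation_def I_def M_def by blast
  have rows: "(\<Sum>i\<in>I. row_sum (M i) r) = 1" for r
    using adm unfolding admissible_perturbation_def I_def M_def by blast
  have p: "p i \<in> wiener_class" if "i \<in> I" for i
    using qt[OF that] unfolding p_def qt_decomposition_def by (intro wiener_add symb_wiener) auto
  have sm: "(\<lambda>c. cmod (M i r c)) summable_on UNIV" if i: "i \<in> I" for i r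
  proof -
    have "(\<lambda>c. cmod (block a b i r c)) summable_on UNIV"
      by (rule has_sum_imp_summable, rule has_sum_finite_neutralI[of "{..Suc r}"])
         (auto simp: block_def)
    moreover have "(\<lambda>c. cmod (toeplitz (\<delta> i) r c)) summable_on UNIV"
      "(\<lambda>c. cmod (E i r c)) summable_on UNIV"
      using qt[OF i] toeplitz_row_abs_summable
      by (auto simp: qt_decomposition_def qt_correction_def)
    ultimately have "(\<lambda>c. cmod (block a b i r c) + (cmod (toeplitz (\<delta> i) r c) + cmod (E i r c)))
        summable_on UNIV"
      by (intro summable_on_add)
    then show ?thesis
    proof (rule summable_on_comparison_test)
      fix c
      have "M i r c = block a b i r c + (toeplitz (\<delta> i) r c + E i r c)"
        using qt[OF i] by (simp add: M_def qt_decomposition_def)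
      then show "cmod (M i r c) \<le>
          cmod (block a b i r c) + (cmod (toeplitz (\<delta> i) r c) + cmod (E i r c))"
        by (metis add_left_mono norm_triangle_ineq order_trans)
    qed simp
  qed
  \<comment> \<open>A nonnegative entry in the complex order is real and equals its modulus, so row
    sums turn into absolute row sums.\<close>
  have "row_sum (M i) r = of_real (N i r)" if i: "i \<in> I" for i r
  proof -
    have "((\<lambda>c. complex_of_real (cmod (M i r c))) has_sum of_real (N i r)) UNIV"
      unfolding N_def by (intro has_sum_of_real has_sum_infsum sm i)
    moreover have "complex_of_real (cmod (M i r c)) = M i r c" for c
      using pos[OF i, of r c] by (simp add: less_eq_complex_def cmod_eq_Re complex_eq_iff)
    ultimately show ?thesis by (simp add: row_sum_def infsumI)
  qed
  then have "complex_of_real (\<Sum>i\<in>I. N i r) = of_real 1" for r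
    using rows[of r] by simp
  then have N1: "(\<Sum>i\<in>I. N i r) = 1" for r
    by (simp only: of_real_eq_iff)
  have finite_le: "(\<Sum>i\<in>I. \<Sum>j\<in>F. cmod (wiener_coeff (p i) j)) \<le> 1" if F: "finite F" for F
  proof (rule LIMSEQ_le_const2)
    show "(\<lambda>r. \<Sum>i\<in>I. \<Sum>j\<in>F. cmod (M i r (nat (int r + j))))
        \<longlonglongrightarrow> (\<Sum>i\<in>I. \<Sum>j\<in>F. cmod (wiener_coeff (p i) j))"
      unfolding M_def p_def
      by (intro tendsto_sum tendsto_norm perturbed_block_diagonal_limit[OF qt])
    \<comment> \<open>Any bound on the absolute values in \<open>F\<close> would do. From row
      \<open>R\<close> on, distinct offsets in \<open>F\<close> meet distinct columns, so the
      entries form part of one row.\<close>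
    define R where "R = (\<Sum>j\<in>F. nat \<bar>j\<bar>)"
    have "(\<Sum>i\<in>I. \<Sum>j\<in>F. cmod (M i r (nat (int r + j)))) \<le> 1" if r: "R \<le> r" for r
    proof -
      have "0 \<le> int r + j" if "j \<in> F" for j
        using member_le_sum[OF that, of "\<lambda>j. nat \<bar>j\<bar>"] F r by (simp add: R_def)
      then have inj: "inj_on (\<lambda>j. nat (int r + j)) F"
        unfolding inj_on_def by (metis add_left_imp_eq eq_nat_nat_iff)
      have "(\<Sum>j\<in>F. cmod (M i r (nat (int r + j)))) \<le> N i r" if "i \<in> I" for i
        using finite_sum_le_infsum[OF sm[OF that], of "(\<lambda>j. nat (int r + j)) ` F" r] F
        by (simp add: sum.reindex[OF inj] N_def)
      then have "(\<Sum>i\<in>I. \<Sum>j\<in>F. cmod (M i r (nat (int r + j)))) \<le> (\<Sum>i\<in>I. N i r)"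
        by (rule sum_mono)
      then show ?thesis by (simp add: N1)
    qed
    then show "\<exists>R. \<forall>r\<ge>R. (\<Sum>i\<in>I. \<Sum>j\<in>F. cmod (M i r (nat (int r + j)))) \<le> 1"
      by blast
  qed
  have "((\<lambda>j. \<Sum>i\<in>I. cmod (wiener_coeff (p i) j)) has_sum (\<Sum>i\<in>I. wiener_norm (p i))) UNIV"
    using has_sum_add[OF wiener_coeff_has_sum(1)[OF p[of "-1"]]
        has_sum_add[OF wiener_coeff_has_sum(1)[OF p[of 0]] wiener_coeff_has_sum(1)[OF p[of 1]]]]
    by (simp add: I_def)
  then have "(\<Sum>i\<in>I. wiener_norm (p i)) \<le> 1"
  proof (rule has_sum_le_finite_sums)
    fix F :: "int set"
    assume "finite F"
    from finite_le[OF this] show "(\<Sum>j\<in>F. \<Sum>i\<in>I. cmod (wiener_coeff (p i) j)) \<le> 1"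
      by (subst sum.swap)
  qed
  then show ?thesis by (simp only: p_def[abs_def] I_def)
qed

section \<open>The perturbation estimate for the minimum modulus solution\<close>

theorem mainTheorem5:
  fixes a b :: "int \<Rightarrow> int \<Rightarrow> real" and g :: "complex \<Rightarrow> complex"
  assumes a_nonneg: "\<And>i j. i \<in> {-1, 0, 1} \<Longrightarrow> j \<in> {-1, 0, 1} \<Longrightarrow> 0 \<le> a i j"
    and b_nonneg: "\<And>i j. i \<in> {-1, 0, 1} \<Longrightarrow> j \<in> {0, 1} \<Longrightarrow> 0 \<le> b i j"
    and a_sum: "(\<Sum>i\<in>{-1, 0, 1}. \<Sum>j\<in>{-1, 0, 1}. a i j) = 1"
    and b_sum: "(\<Sum>i\<in>{-1, 0, 1}. \<Sum>j\<in>{0, 1}. b i j) = 1"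
    and drift: "\<And>r. row_sum (block a b (-1)) r > row_sum (block a b 1) r"
    and g: "min_modulus_solution (symb a) g"
  shows "g \<in> wiener_class \<and>
    (\<exists>C \<rho>. \<rho> > 0 \<and>
      (\<forall>\<Delta> \<delta> E \<delta>g.
        admissible_perturbation (block a b) \<Delta> \<delta> E \<and>
        min_modulus_solution (\<lambda>i z. symb a i z + \<delta> i z) (\<lambda>z. g z + \<delta>g z) \<and>
        (\<Sum>i\<in>{-1, 0, 1}. wiener_norm (\<delta> i)) < \<rho> \<longrightarrow>
          \<delta>g \<in> wiener_class \<and>
          wiener_norm \<delta>g \<le>
            1 / (symb a (-1) 1 - symb a 1 1) * (\<Sum>i\<in>{-1, 0, 1}. wiener_norm (\<delta> i)) +
            C * (\<Sum>i\<in>{-1, 0, 1}. wiener_norm (\<delta> i)) ^ 2)) \<and>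
    ((\<forall>i\<in>{-1, 0, 1}. \<exists>j\<in>{-1, 0, 1}. a i j \<noteq> 0) \<longrightarrow>
      (\<exists>C \<rho>. \<rho> > 0 \<and>
        (\<forall>\<Delta> \<delta> E \<delta>g \<epsilon>.
          admissible_perturbation (block a b) \<Delta> \<delta> E \<and>
          min_modulus_solution (\<lambda>i z. symb a i z + \<delta> i z) (\<lambda>z. g z + \<delta>g z) \<and>
          \<epsilon> = Max ((\<lambda>i. wiener_norm (\<delta> i) / wiener_norm (symb a i)) ` {-1, 0, 1}) \<and>
          \<epsilon> < \<rho> \<longrightarrow>
            \<delta>g \<in> wiener_class \<and>
            wiener_norm \<delta>g / wiener_norm g = wiener_norm \<delta>g \<and>
            wiener_norm \<delta>g \<le> 1 / (symb a (-1) 1 - symb a 1 1) * \<epsilon> + C * \<epsilon> ^ 2)))"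
proof -
  define \<theta> where "\<theta> = symb a (-1) 1 - symb a 1 (1 :: real)"
  have na: "wiener_norm (symb a i) = symb a i 1" if "i \<in> {-1, 0, 1}" for i
    using a_nonneg[OF that] by (simp add: symb_wiener(2) symb_def)
  have na_sum: "wiener_norm (symb a (-1)) + wiener_norm (symb a 0) + wiener_norm (symb a 1) = 1"
    using a_sum by (simp add: na symb_def)
  have "complex_of_real (\<Sum>j\<in>{-1, 0, 1}. a 1 j) < of_real (\<Sum>j\<in>{-1, 0, 1}. a (-1) j)"
    using drift[of 1] unfolding row_sum_block_interior .
  then have \<theta>: "\<theta> > 0" by (simp add: \<theta>_def symb_def less_complex_def)
  have \<theta>_eq: "wiener_norm (symb a 0) + 2 * wiener_norm (symb a 1) = 1 - \<theta>"
    using na_sum by (simp add: \<theta>_def na)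
  have gW: "g \<in> wiener_class" and g_le: "wiener_norm g \<le> 1"
    and g_eq: "\<And>z x. cmod z = 1 \<Longrightarrow> quad_solution (symb a) z x \<Longrightarrow> cmod x \<le> 1 \<Longrightarrow> g z = x"
    using min_modulus_solution_wiener[OF _ _ _ g] na_sum \<theta> \<theta>_eq symb_wiener(1)
    by simp_all
  \<comment> \<open>At \<open>z = 1\<close> the coefficients add up to 1, so 1 solves the equation.
    Uniqueness in the closed disc gives \<open>g 1 = 1\<close>, which bounds the norm of
    \<open>g\<close> from below by 1.\<close>
  have "symb a (-1) (1 :: real) + symb a 0 1 + symb a 1 1 = 1"
    using na_sum by (simp add: na)
  then have "complex_of_real (symb a (-1) 1 + symb a 0 1 + symb a 1 1) = of_real 1"
    by (simp only:)
  then have "quad_solution (symb a) 1 1"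
    by (simp add: quad_solution_def symb_def)
  then have "g 1 = 1" by (intro g_eq) auto
  then have g1: "wiener_norm g = 1"
    using cmod_le_wiener_norm[OF gW, of 1] g_le by simp

  have key: "\<delta>g \<in> wiener_class \<and>
      wiener_norm \<delta>g \<le> 1 / \<theta> * (\<Sum>i\<in>{-1, 0, 1}. wiener_norm (\<delta> i))"
    if adm: "admissible_perturbation (block a b) \<Delta> \<delta> E"
      and mm: "min_modulus_solution (\<lambda>i z. symb a i z + \<delta> i z) (\<lambda>z. g z + \<delta>g z)"
      and small: "(\<Sum>i\<in>{-1, 0, 1}. wiener_norm (\<delta> i)) < \<theta> / 2"
    for \<Delta> \<delta> E \<delta>g
  proof -
    have \<delta>: "\<delta> i \<in> wiener_class" if "i \<in> {-1, 0, 1}" for i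
      using adm that unfolding admissible_perturbation_def qt_decomposition_def by blast
    have \<delta>': "\<delta> (-1) \<in> wiener_class" "\<delta> 0 \<in> wiener_class" "\<delta> 1 \<in> wiener_class"
      by (rule \<delta>, simp)+
    define G where "G z = g z + \<delta>g z" for z
    \<comment> \<open>The contraction constant \<open>1 - \<theta>\<close> grows by at most twice
      the total size of the perturbations; the threshold \<open>\<theta> / 2\<close> keeps it below
      1.\<close>
    have "wiener_norm (\<lambda>z. symb a 0 z + \<delta> 0 z) + 2 * wiener_norm (\<lambda>z. symb a 1 z + \<delta> 1 z) < 1"
      using wiener_add(2)[OF symb_wiener(1) \<delta>'(2), of a 0] wiener_add(2)[OF symb_wiener(1) \<delta>'(3), of a 1]
        \<theta>_eq small wiener_norm_nonneg[of "\<delta> (-1)"] wiener_norm_nonneg[of "\<delta> 0"] by simp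
    from min_modulus_solution_wiener[OF wiener_add(1)[OF symb_wiener(1) \<delta>]
        perturbed_symbols_norm_le_1[OF adm] this mm]
    have G: "G \<in> wiener_class" "wiener_norm G \<le> 1" by (simp_all add: G_def[abs_def])
    have "\<delta>g = (\<lambda>z. G z - g z)" by (simp add: G_def)
    with wiener_minus[OF G(1) gW] have \<delta>g: "\<delta>g \<in> wiener_class" by simp
    define R where "R z = \<delta> (-1) z + \<delta> 0 z * G z + \<delta> 1 z * G z ^ 2" for z
    define S where "S z = (symb a 0 z + symb a 1 z * (g z + G z)) * \<delta>g z" for z
    have R: "R \<in> wiener_class" "wiener_norm R \<le> (\<Sum>i\<in>{-1, 0, 1}. wiener_norm (\<delta> i))"
      using wiener_quadratic[OF \<delta>' G] by (simp_all add: R_def[abs_def])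
    have S: "S \<in> wiener_class" "wiener_norm S \<le> (1 - \<theta>) * wiener_norm \<delta>g"
      using wiener_quadratic_slope[OF symb_wiener(1) symb_wiener(1) gW g_le G \<delta>g, of a 0 a 1] \<theta>_eq
      by (simp_all add: S_def[abs_def])
    have "\<delta>g z = R z + S z" if z: "cmod z = 1" for z
    proof -
      have "quad_solution (symb a) z (g z)" "quad_solution (\<lambda>i z. symb a i z + \<delta> i z) z (G z)"
        using g mm z by (simp_all add: min_modulus_solution_def G_def)
      then have "G z - g z = (symb a (-1) z + \<delta> (-1) z + (symb a 0 z + \<delta> 0 z) * G z +
            (symb a 1 z + \<delta> 1 z) * G z ^ 2) -
          (symb a (-1) z + symb a 0 z * g z + symb a 1 z * g z ^ 2)"
        by (simp add: quad_solution_def)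
      also have "\<dots> = R z + S z"
        by (simp add: R_def S_def \<open>\<delta>g = (\<lambda>z. G z - g z)\<close> algebra_simps power2_eq_square)
      finally show ?thesis by (simp add: G_def)
    qed
    \<comment> \<open>The norm of \<open>\<delta>g\<close> is at most that of \<open>R\<close> plus
      \<open>1 - \<theta>\<close> times itself; moving the latter to the left leaves the factor
      \<open>\<theta>\<close>.\<close>
    from wiener_cong(2)[OF wiener_add(1)[OF R(1) S(1)] this]
    have "\<theta> * wiener_norm \<delta>g \<le> (\<Sum>i\<in>{-1, 0, 1}. wiener_norm (\<delta> i))"
      using wiener_add(2)[OF R(1) S(1)] R(2) S(2) by (simp add: algebra_simps)
    with \<theta> \<delta>g show ?thesis by (simp add: field_simps)
  qed

  have part1: "\<exists>C \<rho>. \<rho> > 0 \<and>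
      (\<forall>\<Delta> \<delta> E \<delta>g.
        admissible_perturbation (block a b) \<Delta> \<delta> E \<and>
        min_modulus_solution (\<lambda>i z. symb a i z + \<delta> i z) (\<lambda>z. g z + \<delta>g z) \<and>
        (\<Sum>i\<in>{-1, 0, 1}. wiener_norm (\<delta> i)) < \<rho> \<longrightarrow>
          \<delta>g \<in> wiener_class \<and>
          wiener_norm \<delta>g \<le>
            1 / \<theta> * (\<Sum>i\<in>{-1, 0, 1}. wiener_norm (\<delta> i)) +
            C * (\<Sum>i\<in>{-1, 0, 1}. wiener_norm (\<delta> i)) ^ 2)"
    \<comment> \<open>The witness 0 for \<open>C\<close> reflects that \<open>key\<close> has no
      quadratic term.\<close>
    by (rule exI[of _ 0], rule exI[of _ "\<theta> / 2"], simp only: mult_zero_left add_0_right)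
       (use \<theta> key in \<open>simp only: half_gt_zero, blast\<close>)

  have part2: "\<exists>C \<rho>. \<rho> > 0 \<and>
      (\<forall>\<Delta> \<delta> E \<delta>g \<epsilon>.
        admissible_perturbation (block a b) \<Delta> \<delta> E \<and>
        min_modulus_solution (\<lambda>i z. symb a i z + \<delta> i z) (\<lambda>z. g z + \<delta>g z) \<and>
        \<epsilon> = Max ((\<lambda>i. wiener_norm (\<delta> i) / wiener_norm (symb a i)) ` {-1, 0, 1}) \<and>
        \<epsilon> < \<rho> \<longrightarrow>
          \<delta>g \<in> wiener_class \<and>
          wiener_norm \<delta>g / wiener_norm g = wiener_norm \<delta>g \<and>
          wiener_norm \<delta>g \<le> 1 / \<theta> * \<epsilon> + C * \<epsilon> ^ 2)"
    if nz: "\<forall>i\<in>{-1, 0, 1}. \<exists>j\<in>{-1, 0, 1}. a i j \<noteq> 0"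
  proof (rule exI[of _ 0], rule exI[of _ "\<theta> / 2"], rule conjI, goal_cases)
    case 1
    show ?case using \<theta> by simp
  next
    case 2
    show ?case
    proof (intro allI impI, elim conjE, goal_cases)
      case (1 \<Delta> \<delta> E \<delta>g \<epsilon>)
      note adm = 1(1) and mm = 1(2) and \<epsilon> = 1(3) and small = 1(4)
      \<comment> \<open>A nonzero coefficient makes the norm of the symbol positive, so the quotient
        defining \<open>\<epsilon>\<close> is genuine and can be cleared.\<close>
      have le: "wiener_norm (\<delta> i) \<le> \<epsilon> * wiener_norm (symb a i)" if i: "i \<in> {-1, 0, 1}" for i
      proof -
        obtain j where j: "j \<in> {-1, 0, 1}" "a i j \<noteq> 0" using nz i by blast
        have "\<bar>a i j\<bar> \<le> wiener_norm (symb a i)"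
          unfolding symb_wiener(2) by (rule member_le_sum[OF j(1)]) auto
        with j(2) have "0 < wiener_norm (symb a i)" by linarith
        moreover have "wiener_norm (\<delta> i) / wiener_norm (symb a i) \<le> \<epsilon>"
          unfolding \<epsilon> using i by (intro Max_ge) auto
        ultimately show ?thesis by (simp add: field_simps)
      qed
      have "(\<Sum>i\<in>{-1, 0, 1}. wiener_norm (\<delta> i)) \<le> (\<Sum>i\<in>{-1, 0, 1}. \<epsilon> * wiener_norm (symb a i))"
        by (rule sum_mono) (rule le)
      \<comment> \<open>The weights sum to 1, so the total perturbation is at most
        \<open>\<epsilon>\<close> itself, with no factor 3.\<close>
      also have "\<dots> = \<epsilon> * (wiener_norm (symb a (-1)) + wiener_norm (symb a 0) + wiener_norm (symb a 1))"
        by (simp add: algebra_simps)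
      finally have sum_le: "(\<Sum>i\<in>{-1, 0, 1}. wiener_norm (\<delta> i)) \<le> \<epsilon>"
        unfolding na_sum by simp
      have K: "\<delta>g \<in> wiener_class"
        "wiener_norm \<delta>g \<le> 1 / \<theta> * (\<Sum>i\<in>{-1, 0, 1}. wiener_norm (\<delta> i))"
        using key[OF adm mm le_less_trans[OF sum_le small]] by auto
      have "1 / \<theta> * (\<Sum>i\<in>{-1, 0, 1}. wiener_norm (\<delta> i)) \<le> 1 / \<theta> * \<epsilon>"
        using \<theta> by (intro mult_left_mono sum_le) simp
      with K(2) have "wiener_norm \<delta>g \<le> 1 / \<theta> * \<epsilon>" by (rule order_trans)
      with K(1) g1 show ?case by simp
    qed
  qed
  from gW part1 part2 show ?thesis unfolding \<theta>_def by blast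
qed

end
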